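(* Let $N,r,k,d\in\mathbb{N}$ with $k\geq d+1$. If $N\geq R_r(k)^d-1$, then every $r$-coloring of $[N]^d$ yields a monochromatic solution to $x_1+\cdots+x_{k-1}=x_k$ with $\{x_1,\dots,x_d\}$ linearly independent; that is, for every $r$-coloring of $[N]^d$ there exist $x_1,\dots,x_k\in[N]^d$, all of the same color, such that $x_1+\cdots+x_{k-1}=x_k$ and the $d$ vectors $x_1,\dots,x_d$ are linearly independent.
   Context: $\mathbb{N}$ denotes the positive integers, $[N]=\{1,2,\dots,N\}$, and $[N]^d\subset\mathbb{Z}^d$ is the set of $d$-tuples of elements of $[N]$, with vector addition. An $r$-coloring of a set is a partition of it into $r$ pairwise disjoint (possibly empty) subsets, called colors, i.e. a function from the set to $\{1,\dots,r\}$. A collection of elements is monochromatic if they are all the same color. The elements $x_1,\dots,x_k$ of a solution are not required to be distinct, apart from what linear independence forces. Linear independence is in the usual sense over $\mathbb{R}$ (equivalently over $\mathbb{Q}$), for the list of vectors. For $r,k\in\mathbb{N}$, the Ramsey number $R_r(k)$ is the minimum $M\in\mathbb{N}$ such that every $r$-coloring of the edges of a complete graph on $M$ vertices yields a complete subgraph on $k$ vertices all of whose edges have the same color (it exists by Ramsey's Theorem). *)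

theory Defs
  imports "HOL-Analysis.Analysis" "HOL-Library.Ramsey"
begin

text \<open>The number \<open>R_r(k)\<close>. Edges of the complete graph on \<open>{..<M}\<close> are its 2-element subsets;
  \<open>partn {..<M} k 2 {1..r}\<close> says that every colouring of them by \<open>{1..r}\<close> is constant on the edges
  inside some \<open>k\<close>-element vertex set. By \<open>ex_partn\<close> below, the minimum exists.\<close>

definition ramsey_number :: "nat \<Rightarrow> nat \<Rightarrow> nat" where
  "ramsey_number r k = (LEAST M. M \<ge> 1 \<and> partn {..<M} k 2 {1..r})"

lemma ex_partn:
  fixes r k :: nat
  assumes "r \<ge> 1" "k \<ge> 1"
  shows "\<exists>M::nat. M \<ge> 1 \<and> partn {..<M} k 2 {1..r}"
proof -
  obtain M :: nat where M: "partn_lst {..<M} (replicate r k) 2"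
    using ramsey_full by blast
  have P: "partn {..<M} k 2 {1..r}"
    unfolding partn_def
  proof
    fix f assume f: "f \<in> nsets {..<M} 2 \<rightarrow> {1..r}"
    have "(\<lambda>e. f e - 1) \<in> nsets {..<M} 2 \<rightarrow> {..<r}"
      using f assms by (fastforce simp: Pi_iff)
    from partn_lstE[OF M this] obtain i H where i: "i < r" and H: "H \<in> nsets {..<M} k"
      and fH: "(\<lambda>e. f e - 1) ` nsets H 2 \<subseteq> {i}"
      by (metis length_replicate nth_replicate)
    have sub: "nsets H 2 \<subseteq> nsets {..<M} 2"
      using H by (intro nsets_mono) (auto simp: nsets_def)
    have "f ` nsets H 2 \<subseteq> {Suc i}"
    proof clarify
      fix e assume e: "e \<in> nsets H 2"
      then have "f e \<ge> 1" using f sub by (auto simp: Pi_iff)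
      moreover have "f e - 1 = i" using fH e by auto
      ultimately show "f e = Suc i" by simp
    qed
    then show "\<exists>\<xi>\<in>{1..r}. monochromatic {..<M} k 2 f \<xi>"
      using i H unfolding monochromatic_def by (intro bexI[of _ "Suc i"]) auto
  qed
  have "M \<ge> 1"
  proof (rule ccontr)
    assume "\<not> M \<ge> 1"
    then have "nsets {..<M} k = {}" using assms by (simp add: nsets_eq_empty_iff)
    moreover have "(\<lambda>_. 1) \<in> nsets {..<M} 2 \<rightarrow> {1..r}" using assms by (simp add: Pi_iff)
    ultimately show False
      using bspec[OF P[unfolded partn_def], of "\<lambda>_. 1"] unfolding monochromatic_def by blast
  qed
  with P show ?thesis by blast
qed

text \<open>The set \<open>[N]\<^sup>d\<close>, where \<open>d = CARD('d)\<close>.\<close>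

definition grid :: "nat \<Rightarrow> (int ^ 'd) set" where
  "grid N = {x. \<forall>i. x $ i \<in> {1..int N}}"

definition real_vec :: "int ^ 'd \<Rightarrow> real ^ 'd" where
  "real_vec x = (\<chi> i. real_of_int (x $ i))"

text \<open>Linear independence of a family rather than of a set: a repeated vector makes the family
  dependent.\<close>

definition lin_indep_family :: "'i set \<Rightarrow> ('i \<Rightarrow> 'v::real_vector) \<Rightarrow> bool" where
  "lin_indep_family I v \<longleftrightarrow> inj_on v I \<and> independent (v ` I)"

lemma lin_indep_family_iff:
  fixes v :: "'i \<Rightarrow> 'v::real_vector"
  assumes "finite I"
  shows "lin_indep_family I v \<longleftrightarrow>
    (\<forall>a. (\<Sum>i\<in>I. a i *\<^sub>R v i) = 0 \<longrightarrow> (\<forall>i\<in>I. a i = 0))" (is "_ \<longleftrightarrow> ?R")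
proof
  assume L: "lin_indep_family I v"
  then have inj: "inj_on v I" and ind: "independent (v ` I)"
    by (auto simp: lin_indep_family_def)
  show ?R
  proof (intro allI impI ballI)
    fix a i assume s: "(\<Sum>i\<in>I. a i *\<^sub>R v i) = 0" and i: "i \<in> I"
    let ?u = "\<lambda>w. a (the_inv_into I v w)"
    have "(\<Sum>w\<in>v ` I. ?u w *\<^sub>R w) = (\<Sum>i\<in>I. a i *\<^sub>R v i)"
      using inj by (simp add: sum.reindex the_inv_into_f_f)
    then have "?u (v i) = 0"
      using independentD[OF ind _ subset_refl, of ?u "v i"] s i assms by simp
    then show "a i = 0" using inj i by (simp add: the_inv_into_f_f)
  qed
next
  assume R: ?R
  have inj: "inj_on v I"
  proof (rule inj_onI, rule ccontr)
    fix i j assume ij: "i \<in> I" "j \<in> I" "v i = v j" "i \<noteq> j"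
    define a :: "'i \<Rightarrow> real" where "a l = (if l = i then 1 else 0) - (if l = j then 1 else 0)" for l
    have "(\<Sum>l\<in>I. a l *\<^sub>R v l) = 0"
      using ij assms
      by (simp add: a_def scaleR_diff_left sum_subtractf if_distrib[of "\<lambda>c. c *\<^sub>R _"] cong: if_cong)
    with R ij(1) have "a i = 0" by blast
    with ij(4) show False by (simp add: a_def)
  qed
  moreover have "independent (v ` I)"
  proof (rule independent_if_scalars_zero)
    show "finite (v ` I)" using assms by simp
    fix u w assume "(\<Sum>x\<in>v ` I. u x *\<^sub>R x) = 0" "w \<in> v ` I"
    then show "u w = 0"
      using R[rule_format, of "u \<circ> v"] inj by (auto simp: sum.reindex)
  qed
  ultimately show "lin_indep_family I v" by (simp add: lin_indep_family_def)
qed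

end

theory Submission
  imports Defs "HOL-Computational_Algebra.Polynomial"
begin

text \<open>Colour the edge \<open>{a < b}\<close> of a complete graph on positive integers by the colour of the
  difference \<open>v b - v a\<close>. The edges inside a monochromatic clique \<open>t 0 < \<dots> < t (k - 1)\<close> then give
  a solution: the \<open>k - 1\<close> consecutive increments \<open>v (t i) - v (t (i - 1))\<close> telescope to the
  increment along the edge joining the first vertex to the last, and all of them have one colour.

  It remains to choose \<open>v\<close> so that increments along any \<open>d + 1\<close> vertices are linearly independent,
  that is, so that any \<open>d + 1\<close> points of \<open>v\<close> are affinely independent. The moment curve
  \<open>v a = (a, a\<^sup>2, \<dots>, a\<^sup>d)\<close> has this property (\<open>moment_increments_independent\<close>), because a
  polynomial of degree \<open>d\<close> can be prescribed to vanish at all but one of \<open>d + 1\<close> points. On the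
  parameters \<open>1, \<dots>, M\<close> with \<open>M = R_r(k)\<close> its increments have coordinates between \<open>1\<close> and
  \<open>M\<^sup>d - 1\<close>, which is where the bound on \<open>N\<close> comes from.\<close>

text \<open>The coordinates of the space are indexed by an arbitrary finite type, so the exponents are
  supplied by a function \<open>e\<close>, which will be a bijection onto \<open>{1..d}\<close>.\<close>

definition moment_curve :: "('d \<Rightarrow> nat) \<Rightarrow> nat \<Rightarrow> int ^ 'd" where
  "moment_curve e a = (\<chi> s. int a ^ e s)"

lemma moment_curve_diff_in_grid:
  assumes e: "\<And>s. e s \<in> {1..d}" and ab: "1 \<le> a" "a < b" "b \<le> M" and N: "M ^ d - 1 \<le> N"
  shows "moment_curve e b - moment_curve e a \<in> grid N"
proof -
  have "int b ^ e s - int a ^ e s \<in> {1..int N}" for s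
  proof -
    have es: "1 \<le> e s" "e s \<le> d" using e[of s] by auto
    have "a ^ e s < b ^ e s" using ab es by (intro power_strict_mono) auto
    moreover have "1 \<le> a ^ e s" using ab by simp
    moreover have "b ^ e s \<le> M ^ d"
    proof -
      have "b ^ e s \<le> b ^ d" using ab es by (intro power_increasing) auto
      also have "\<dots> \<le> M ^ d" using ab by (intro power_mono) auto
      finally show ?thesis .
    qed
    ultimately have "a ^ e s < b ^ e s" "b ^ e s \<le> N + a ^ e s" using N by linarith+
    then have "int (a ^ e s) < int (b ^ e s)" "int (b ^ e s) \<le> int (N + a ^ e s)"
      by (simp_all only: of_nat_less_iff of_nat_le_iff)
    then show ?thesis by simp
  qed
  then show ?thesis by (simp add: grid_def moment_curve_def)
qed

text \<open>Annihilating the increments of the powers \<open>x, \<dots>, x\<^sup>d\<close> means annihilating those of every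
  polynomial of degree at most \<open>d\<close>, since constants have no increments.\<close>

lemma poly_increments_annihilated:
  fixes t a :: "nat \<Rightarrow> real"
  assumes "\<And>n. n \<in> {1..d} \<Longrightarrow> (\<Sum>j\<in>J. a j * (t j ^ n - t (j - 1) ^ n)) = 0"
    and "degree p \<le> d"
  shows "(\<Sum>j\<in>J. a j * (poly p (t j) - poly p (t (j - 1)))) = 0"
proof -
  have "(\<Sum>j\<in>J. a j * (poly p (t j) - poly p (t (j - 1)))) =
      (\<Sum>j\<in>J. \<Sum>n\<le>degree p. coeff p n * (a j * (t j ^ n - t (j - 1) ^ n)))"
    unfolding poly_altdef sum_subtractf[symmetric] right_diff_distrib[symmetric] sum_distrib_left
    by (simp add: mult.left_commute)
  also have "\<dots> = (\<Sum>n\<le>degree p. coeff p n * (\<Sum>j\<in>J. a j * (t j ^ n - t (j - 1) ^ n)))"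
    by (subst sum.swap) (simp add: sum_distrib_left)
  also have "\<dots> = 0"
  proof (intro sum.neutral ballI)
    fix n assume "n \<in> {..degree p}"
    then show "coeff p n * (\<Sum>j\<in>J. a j * (t j ^ n - t (j - 1) ^ n)) = 0"
      using assms by (cases "n = 0") auto
  qed
  finally show ?thesis .
qed

text \<open>The coefficients vanish one after the other. If \<open>a j = 0\<close> for \<open>j < m\<close>, test against the
  polynomial of degree \<open>d\<close> whose roots are the points other than \<open>t (m - 1)\<close>: among the remaining
  increments only the \<open>m\<close>-th involves that point, so \<open>a m = 0\<close>.\<close>

lemma moment_increments_independent:
  fixes t a :: "nat \<Rightarrow> real"
  assumes inj: "inj_on t {0..d}"
    and ann: "\<And>n. n \<in> {1..d} \<Longrightarrow> (\<Sum>j\<in>{1..d}. a j * (t j ^ n - t (j - 1) ^ n)) = 0"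
  shows "m \<in> {1..d} \<Longrightarrow> a m = 0"
proof (induction m rule: less_induct)
  case (less m)
  define p where "p = (\<Prod>j\<in>{0..d} - {m - 1}. [:- t j, 1:])"
  have "degree p \<le> (\<Sum>j\<in>{0..d} - {m - 1}. degree [:- t j, 1:])"
    using degree_prod_sum_le[of "{0..d} - {m - 1}" "\<lambda>j. [:- t j, 1:]"] by (simp add: p_def)
  also have "\<dots> = d" using less.prems by auto
  finally have deg: "degree p \<le> d" .
  have p0: "poly p (t j) = 0" if "j \<le> d" "j \<noteq> m - 1" for j
    using that by (auto simp: p_def poly_prod)
  have p1: "poly p (t (m - 1)) \<noteq> 0"
    using inj less.prems by (auto simp: p_def poly_prod inj_on_def)
  have "0 = (\<Sum>j\<in>{1..d}. a j * (poly p (t j) - poly p (t (j - 1))))"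
    using poly_increments_annihilated[OF ann deg] by simp
  also have "\<dots> = (\<Sum>j\<in>{1..d}. if j = m then - (a m * poly p (t (m - 1))) else 0)"
  proof (intro sum.cong refl)
    fix j assume j: "j \<in> {1..d}"
    consider "j < m" | "j = m" | "j > m" by linarith
    then show "a j * (poly p (t j) - poly p (t (j - 1))) =
        (if j = m then - (a m * poly p (t (m - 1))) else 0)"
    proof cases
      case 1
      then show ?thesis using less.IH j by simp
    next
      case 2
      have "poly p (t m) = 0" using less.prems by (intro p0) auto
      with 2 show ?thesis by simp
    next
      case 3
      then have "poly p (t j) = 0" "poly p (t (j - 1)) = 0"
        using j less.prems by (auto intro!: p0)
      with 3 show ?thesis by simp
    qed
  qed
  also have "\<dots> = - (a m * poly p (t (m - 1)))" using less.prems by simp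
  finally show ?case using p1 by simp
qed

lemma lin_indep_family_cong:
  assumes "\<And>i. i \<in> I \<Longrightarrow> v i = w i"
  shows "lin_indep_family I v \<longleftrightarrow> lin_indep_family I w"
proof -
  have "inj_on v I \<longleftrightarrow> inj_on w I" using assms by (rule inj_on_cong)
  moreover have "v ` I = w ` I" using assms by (intro image_cong refl)
  ultimately show ?thesis by (simp add: lin_indep_family_def)
qed

lemma moment_curve_increments_independent:
  fixes e :: "'d::finite \<Rightarrow> nat" and t :: "nat \<Rightarrow> nat"
  assumes e: "{1..d} \<subseteq> range e" and inj: "inj_on t {0..d}"
  shows "lin_indep_family {1..d}
    (\<lambda>i. real_vec (moment_curve e (t i) - moment_curve e (t (i - 1))))"
proof -
  have "a m = 0"
    if z: "(\<Sum>i\<in>{1..d}. a i *\<^sub>R real_vec (moment_curve e (t i) - moment_curve e (t (i - 1)))) = 0"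
      and m: "m \<in> {1..d}" for a m
  proof (rule moment_increments_independent[OF _ _ m])
    show "inj_on (\<lambda>i. real (t i)) {0..d}" using inj by (simp add: inj_on_def)
    fix n assume "n \<in> {1..d}"
    then obtain s where s: "n = e s" using e by blast
    have "(\<Sum>i\<in>{1..d}. a i *\<^sub>R real_vec (moment_curve e (t i) - moment_curve e (t (i - 1)))) $ s = 0"
      using z by simp
    then show "(\<Sum>i\<in>{1..d}. a i * (real (t i) ^ n - real (t (i - 1)) ^ n)) = 0"
      by (simp add: s real_vec_def moment_curve_def)
  qed
  then show ?thesis by (subst lin_indep_family_iff) auto
qed

lemma ramsey_number_partn:
  assumes "r \<ge> 1" "k \<ge> 1"
  shows "partn {..<ramsey_number r k} k 2 {1..r}"
  using LeastI_ex[OF ex_partn[OF assms]] by (simp add: ramsey_number_def)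

text \<open>The pairwise form of the Ramsey property, with the clique listed increasingly. The vertices
  are shifted from \<open>{..<M}\<close> to \<open>{1..M}\<close>, so that the powers of a vertex are at least \<open>1\<close>.\<close>

lemma ramsey_increasing_clique:
  fixes g :: "nat \<Rightarrow> nat \<Rightarrow> nat"
  assumes P: "partn {..<M} k 2 {1..r}"
    and g: "\<And>a b. 1 \<le> a \<Longrightarrow> a < b \<Longrightarrow> b \<le> M \<Longrightarrow> g a b \<in> {1..r}"
  shows "\<exists>t. \<exists>q\<in>{1..r}. \<forall>j<k. \<forall>i<j.
    1 \<le> t i \<and> t i < t j \<and> t j \<le> M \<and> g (t i) (t j) = q"
proof -
  define f where "f E = g (Suc (Min E)) (Suc (Max E))" for E
  have "f \<in> nsets {..<M} 2 \<rightarrow> {1..r}"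
  proof
    fix E assume "E \<in> nsets {..<M} 2"
    then obtain x y where "E = {x, y}" "x < M" "y < M" "x < y"
      by (auto simp: nsets_2_eq) (metis insert_commute nat_neq_iff)
    then show "f E \<in> {1..r}" using g[of "Suc x" "Suc y"] by (simp add: f_def)
  qed
  then obtain q H where q: "q \<in> {1..r}" and H: "H \<in> nsets {..<M} k"
    and fH: "f ` nsets H 2 \<subseteq> {q}"
    using P unfolding partn_def monochromatic_def by blast
  then have H': "finite H" "card H = k" "H \<subseteq> {..<M}" by (auto simp: nsets_def)
  define h where "h i = sorted_list_of_set H ! i" for i
  have hH: "h i \<in> H" if "i < k" for i
    using that H' by (metis h_def length_sorted_list_of_set nth_mem set_sorted_list_of_set)
  then have hM: "h i < M" if "i < k" for i using that H'(3) by blast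
  have hmono: "h i < h j" if "i < j" "j < k" for i j
    unfolding h_def using that H'
    by (intro sorted_wrt_nth_less[OF strict_sorted_list_of_set]) auto
  have "g (Suc (h i)) (Suc (h j)) = q" if "i < j" "j < k" for i j
  proof -
    have "{h i, h j} \<in> nsets H 2"
      using hH[of i] hH[of j] hmono[OF that] that by (auto simp: nsets_def)
    then have "f {h i, h j} = q" using fH by blast
    then show ?thesis using hmono[OF that] by (simp add: f_def)
  qed
  then have "\<forall>j<k. \<forall>i<j. 1 \<le> Suc (h i) \<and> Suc (h i) < Suc (h j) \<and> Suc (h j) \<le> M \<and>
      g (Suc (h i)) (Suc (h j)) = q"
    using hmono hM by (simp add: Suc_le_eq)
  with q show ?thesis by (intro exI[of _ "\<lambda>i. Suc (h i)"] bexI[of _ q])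
qed

theorem theorem1p5:
  fixes N r k :: nat and c :: "int ^ 'd \<Rightarrow> nat"
  assumes "N \<ge> 1" and "r \<ge> 1" and "k \<ge> 1"
    and "k \<ge> CARD('d) + 1"
    and "N \<ge> ramsey_number r k ^ CARD('d) - 1"
    and "c \<in> grid N \<rightarrow> {1..r}"
  shows "\<exists>x :: nat \<Rightarrow> int ^ 'd.
      (\<forall>i\<in>{1..k}. x i \<in> grid N) \<and>
      (\<exists>q\<in>{1..r}. \<forall>i\<in>{1..k}. c (x i) = q) \<and>
      (\<Sum>i=1..k - 1. x i) = x k \<and>
      lin_indep_family {1..CARD('d)} (\<lambda>i. real_vec (x i))"
proof -
  obtain e :: "'d \<Rightarrow> nat" where "bij_betw e UNIV {1..CARD('d)}"
    using finite_same_card_bij[of "UNIV :: 'd set" "{1..CARD('d)}"] by auto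
  then have e: "range e = {1..CARD('d)}" by (simp add: bij_betw_def)
  define v where "v = moment_curve e"
  have vgrid: "v b - v a \<in> grid N" if "1 \<le> a" "a < b" "b \<le> ramsey_number r k" for a b
    unfolding v_def using e that assms(5) by (intro moment_curve_diff_in_grid) auto
  have "c (v b - v a) \<in> {1..r}" if "1 \<le> a" "a < b" "b \<le> ramsey_number r k" for a b
    using vgrid[OF that] assms(6) by blast
  then have "\<exists>t. \<exists>q\<in>{1..r}. \<forall>j<k. \<forall>i<j.
      1 \<le> t i \<and> t i < t j \<and> t j \<le> ramsey_number r k \<and> c (v (t j) - v (t i)) = q"
    by (rule ramsey_increasing_clique[OF ramsey_number_partn[OF assms(2,3)]])
  then obtain t q where q: "q \<in> {1..r}"
    and "\<forall>j<k. \<forall>i<j.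
      1 \<le> t i \<and> t i < t j \<and> t j \<le> ramsey_number r k \<and> c (v (t j) - v (t i)) = q"
    by (elim exE bexE)
  then have t: "1 \<le> t i \<and> t i < t j \<and> t j \<le> ramsey_number r k \<and> c (v (t j) - v (t i)) = q"
    if "i < j" "j < k" for i j using that by simp
  define x where "x i = (if i = k then v (t (k - 1)) - v (t 0) else v (t i) - v (t (i - 1)))" for i
  have k: "2 \<le> k" using assms(4) zero_less_card_finite[where 'a='d] by linarith
  have edge: "\<exists>i' j'. i' < j' \<and> j' < k \<and> x i = v (t j') - v (t i')" if "i \<in> {1..k}" for i
  proof (cases "i = k")
    case True
    then show ?thesis using k by (intro exI[of _ 0] exI[of _ "k - 1"]) (simp add: x_def)
  next
    case False
    then show ?thesis using that by (intro exI[of _ "i - 1"] exI[of _ i]) (simp add: x_def)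
  qed
  have "x i \<in> grid N \<and> c (x i) = q" if "i \<in> {1..k}" for i
    using edge[OF that] t vgrid by metis
  moreover have "(\<Sum>i=1..k - 1. x i) = x k"
  proof -
    have "(\<Sum>i=1..k - 1. x i) = (\<Sum>i=Suc 0..k - 1. v (t i) - v (t (i - 1)))"
      using k by (intro sum.cong) (auto simp: x_def)
    also have "\<dots> = v (t (k - 1)) - v (t 0)"
      by (rule sum_telescope'') simp
    finally show ?thesis by (simp add: x_def)
  qed
  moreover have "lin_indep_family {1..CARD('d)} (\<lambda>i. real_vec (x i))"
  proof -
    have "t i \<noteq> t j" if "i \<le> CARD('d)" "j \<le> CARD('d)" "i \<noteq> j" for i j
      using that t[of i j] t[of j i] assms(4) by (cases "i < j") auto
    then have "inj_on t {0..CARD('d)}" by (intro inj_onI) (metis atLeastAtMost_iff)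
    then have "lin_indep_family {1..CARD('d)} (\<lambda>i. real_vec (v (t i) - v (t (i - 1))))"
      unfolding v_def using e by (intro moment_curve_increments_independent) auto
    moreover have "x i = v (t i) - v (t (i - 1))" if "i \<in> {1..CARD('d)}" for i
      using that assms(4) by (auto simp: x_def)
    ultimately show ?thesis
      using lin_indep_family_cong[where I = "{1..CARD('d)}" and v = "\<lambda>i. real_vec (x i)"
          and w = "\<lambda>i. real_vec (v (t i) - v (t (i - 1)))"] by metis
  qed
  ultimately show ?thesis using q by blast
qed

end
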